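(* For every graph $G$ and integers $k\ge 2$, $d\ge 1$, \[\left\lceil\frac{|V(G)|}{\alpha^k_d(G)}\right\rceil\le\chi^k_d(G)\le\left\lceil\frac{|V(G)|-\alpha^k_d(G)}{k-1}\right\rceil+1\] and \[\left\lceil\frac{\omega^k_d(G)}{k-1}\right\rceil\le\chi^k_d(G).\]
   Context: All graphs are simple and undirected with nonempty vertex set. A shortest path in a graph $G$ is a path between some vertices $u,v$ whose length (number of edges) equals the graph distance between $u$ and $v$. A set $S\subseteq V(G)$ is $k,d$-independent in $G$ if every shortest path in $G$ of length at most $d$ contains fewer than $k$ vertices of $S$; $\alpha^k_d(G)$ is the supremum of the sizes of $k,d$-independent sets. The $k,d$-chromatic number $\chi^k_d(G)$ is the least positive integer $c$ such that some coloring $V(G)\to\{1,\dots,c\}$ has all color classes $k,d$-independent. A set $S\subseteq V(G)$ is a $k,d$-clique in $G$ if every $k$-element subset of $S$ is contained in some shortest path of $G$ of length at most $d$ (sets with fewer than $k$ elements are vacuously $k,d$-cliques); $\omega^k_d(G)$ is the supremum of the sizes of $k,d$-cliques in $G$. *)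

theory Defs
  imports Complex_Main "HOL-Library.Extended_Real" "HOL-Library.FuncSet"
begin

text \<open>Graphs may be infinite. Sizes and graph parameters are therefore extended naturals;
  no distinction is made between infinite cardinalities.\<close>

definition simple_graph :: "'a set \<Rightarrow> 'a set set \<Rightarrow> bool" where
  "simple_graph V E \<longleftrightarrow> V \<noteq> {} \<and> (\<forall>e\<in>E. e \<subseteq> V \<and> card e = 2)"

definition ecard :: "'a set \<Rightarrow> enat" where
  "ecard A = (if finite A then enat (card A) else \<infinity>)"

text \<open>A path is the nonempty list of its vertices, in order; a single vertex is a path of length 0.\<close>

definition is_path :: "'a set \<Rightarrow> 'a set set \<Rightarrow> 'a list \<Rightarrow> bool" where
  "is_path V E p \<longleftrightarrow>
     p \<noteq> [] \<and> set p \<subseteq> V \<and> distinct p \<and> successively (\<lambda>x y. {x, y} \<in> E) p"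

definition path_length :: "'a list \<Rightarrow> nat" where
  "path_length p = length p - 1"

text \<open>The distance is \<open>\<infinity>\<close> (the infimum of the empty set) between different components.\<close>

definition graph_dist :: "'a set \<Rightarrow> 'a set set \<Rightarrow> 'a \<Rightarrow> 'a \<Rightarrow> enat" where
  "graph_dist V E u v =
     Inf {enat (path_length p) | p. is_path V E p \<and> hd p = u \<and> last p = v}"

definition shortest_path :: "'a set \<Rightarrow> 'a set set \<Rightarrow> 'a list \<Rightarrow> bool" where
  "shortest_path V E p \<longleftrightarrow>
     is_path V E p \<and> enat (path_length p) = graph_dist V E (hd p) (last p)"

definition kd_independent :: "nat \<Rightarrow> nat \<Rightarrow> 'a set \<Rightarrow> 'a set set \<Rightarrow> 'a set \<Rightarrow> bool" where
  "kd_independent k d V E S \<longleftrightarrow>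
     S \<subseteq> V \<and> (\<forall>p. shortest_path V E p \<and> path_length p \<le> d \<longrightarrow> card (set p \<inter> S) < k)"

definition kd_alpha :: "nat \<Rightarrow> nat \<Rightarrow> 'a set \<Rightarrow> 'a set set \<Rightarrow> enat" where
  "kd_alpha k d V E = Sup {ecard S | S. kd_independent k d V E S}"

definition kd_coloring ::
    "nat \<Rightarrow> nat \<Rightarrow> 'a set \<Rightarrow> 'a set set \<Rightarrow> nat \<Rightarrow> ('a \<Rightarrow> nat) \<Rightarrow> bool" where
  "kd_coloring k d V E c f \<longleftrightarrow>
     f \<in> V \<rightarrow> {1..c} \<and> (\<forall>i\<in>{1..c}. kd_independent k d V E {v \<in> V. f v = i})"

text \<open>The value is \<open>\<infinity>\<close> if no finite number of colors suffices (only possible for infinite graphs).\<close>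

definition kd_chi :: "nat \<Rightarrow> nat \<Rightarrow> 'a set \<Rightarrow> 'a set set \<Rightarrow> enat" where
  "kd_chi k d V E = Inf {enat c | c. c \<ge> 1 \<and> (\<exists>f. kd_coloring k d V E c f)}"

definition kd_clique :: "nat \<Rightarrow> nat \<Rightarrow> 'a set \<Rightarrow> 'a set set \<Rightarrow> 'a set \<Rightarrow> bool" where
  "kd_clique k d V E S \<longleftrightarrow>
     S \<subseteq> V \<and>
     (\<forall>T \<subseteq> S. finite T \<and> card T = k \<longrightarrow>
        (\<exists>p. shortest_path V E p \<and> path_length p \<le> d \<and> T \<subseteq> set p))"

definition kd_omega :: "nat \<Rightarrow> nat \<Rightarrow> 'a set \<Rightarrow> 'a set set \<Rightarrow> enat" where
  "kd_omega k d V E = Sup {ecard S | S. kd_clique k d V E S}"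

text \<open>Ceiling, extended to the infinite values. Library conventions for indeterminate forms of
  type \<^typ>\<open>ereal\<close>: \<open>\<infinity> / \<infinity> = 0\<close> and \<open>\<infinity> - \<infinity> = \<infinity>\<close>. In quotients and
  differences of the number of vertices and the independence number they occur only when both
  are infinite.\<close>

definition eceiling :: "ereal \<Rightarrow> ereal" where
  "eceiling x = (case x of ereal r \<Rightarrow> ereal (of_int \<lceil>r\<rceil>) | PInfty \<Rightarrow> \<infinity> | MInfty \<Rightarrow> -\<infinity>)"

end

theory Submission
  imports Defs
begin

text \<open>The lower bounds hold because a coloring with \<open>c\<close> colors splits any set into \<open>c\<close> parts: a color
  class has at most \<open>\<alpha>\<close> vertices, and it meets a clique in at most \<open>k - 1\<close> vertices, since \<open>k\<close> common
  vertices would lie on one short shortest path. For the upper bound, give one color to a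
  largest independent set and color the remaining vertices in groups of \<open>k - 1\<close>, every such group
  being too small to violate independence. If \<open>V\<close> is infinite, the upper bound is \<open>\<infinity>\<close>.\<close>

text \<open>Rounding up cannot cross an integer, so both lower bounds on \<open>kd_chi\<close> need
  to be proved only for the bare quotients.\<close>

lemma eceiling_le:
  assumes "x \<le> ereal (of_int n)"
  shows "eceiling x \<le> ereal (of_int n)"
  using assms by (cases x) (auto simp: eceiling_def ceiling_le_iff)

lemma kd_independent_empty: "0 < k \<Longrightarrow> kd_independent k d V E {}"
  by (simp add: kd_independent_def)

lemma kd_independent_small:
  assumes "S \<subseteq> V" "finite S" "card S < k"
  shows "kd_independent k d V E S"
  unfolding kd_independent_def
  using assms by (metis card_mono inf_le2 le_less_trans)

lemma ecard_le_kd_alpha: "kd_independent k d V E S \<Longrightarrow> ecard S \<le> kd_alpha k d V E"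
  unfolding kd_alpha_def by (rule Sup_upper) blast

text \<open>Since \<open>k\<close> is at least 2, any single vertex is an independent set. This
  makes division by a finite \<open>kd_alpha\<close> sound.\<close>

lemma kd_alpha_positive:
  assumes "V \<noteq> {}" "2 \<le> k"
  shows "0 < kd_alpha k d V E"
proof -
  obtain v where "v \<in> V" using assms by blast
  then have "kd_independent k d V E {v}"
    using assms by (intro kd_independent_small) auto
  from ecard_le_kd_alpha[OF this] show ?thesis
    by (cases "kd_alpha k d V E") (auto simp: ecard_def zero_enat_def)
qed

lemma kd_alpha_attained:
  assumes "kd_alpha k d V E = enat a" "0 < k"
  obtains S where "kd_independent k d V E S" "ecard S = enat a"
proof -
  let ?A = "{ecard S | S. kd_independent k d V E S}"
  have ne: "?A \<noteq> {}" using kd_independent_empty[OF assms(2)] by blast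
  have sup: "Sup ?A = enat a" using assms(1) by (simp add: kd_alpha_def)
  \<comment> \<open>In \<open>enat\<close> the supremum of an infinite set is \<infinity>; that of a
    finite nonempty set is its maximum, hence a member.\<close>
  then have "finite ?A" using ne by (metis (lifting) Sup_enat_def enat.distinct(1))
  then have "Sup ?A \<in> ?A" using Max_in[OF _ ne] ne by (simp only: Sup_enat_def if_False if_True)
  then have "enat a \<in> ?A" using sup by simp
  then show thesis using that by force
qed

lemma kd_chi_attained:
  assumes "kd_chi k d V E = enat c"
  obtains f where "kd_coloring k d V E c f"
proof -
  let ?C = "{enat c | c. c \<ge> 1 \<and> (\<exists>f. kd_coloring k d V E c f)}"
  have inf: "Inf ?C = enat c" using assms by (simp add: kd_chi_def)
  \<comment> \<open>The infimum of the empty set is \<infinity>; any other infimum in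
    \<open>enat\<close> is a least element.\<close>
  then have "?C \<noteq> {}" by (metis (lifting) Inf_enat_def enat.distinct(1))
  then have "Inf ?C \<in> ?C" unfolding Inf_enat_def by (simp only: if_False) (metis (lifting) LeastI ex_in_conv)
  then have "enat c \<in> ?C" using inf by simp
  then show thesis using that by auto
qed

text \<open>The counting shared by both lower bounds: \<open>S\<close> is the union of its
  \<open>c\<close> color parts. It serves for \<open>S = V\<close> with \<open>b\<close> the
  independence number, and for a clique \<open>S\<close> with \<open>b = k - 1\<close>.\<close>

lemma card_le_if_coloring:
  assumes "kd_coloring k d V E c f" "S \<subseteq> V"
    and part: "\<And>i. i \<in> {1..c} \<Longrightarrow> finite (S \<inter> {v \<in> V. f v = i}) \<and> card (S \<inter> {v \<in> V. f v = i}) \<le> b"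
  shows "finite S \<and> card S \<le> c * b"
proof -
  let ?P = "\<lambda>i. S \<inter> {v \<in> V. f v = i}"
  have eq: "S = (\<Union>i\<in>{1..c}. ?P i)"
    using assms(1,2) by (auto simp: kd_coloring_def Pi_iff)
  have "finite (\<Union>i\<in>{1..c}. ?P i)" using part by blast
  moreover have "card (\<Union>i\<in>{1..c}. ?P i) \<le> (\<Sum>i\<in>{1..c}. card (?P i))"
    by (rule card_UN_le) simp
  moreover have "\<dots> \<le> c * b"
    using sum_bounded_above[of "{1..c}" "\<lambda>i. card (?P i)" b] part by simp
  ultimately have "finite (\<Union>i\<in>{1..c}. ?P i) \<and> card (\<Union>i\<in>{1..c}. ?P i) \<le> c * b" by linarith
  with eq show ?thesis by simp
qed

lemma card_le_colors_times_alpha: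
  assumes col: "kd_coloring k d V E c f" and "kd_alpha k d V E = enat a"
  shows "finite V \<and> card V \<le> c * a"
proof (rule card_le_if_coloring[OF col order_refl])
  fix i assume "i \<in> {1..c}"
  then have "kd_independent k d V E {v \<in> V. f v = i}"
    using col by (simp add: kd_coloring_def)
  from ecard_le_kd_alpha[OF this]
  have "ecard {v \<in> V. f v = i} \<le> enat a" using assms(2) by simp
  moreover have "V \<inter> {v \<in> V. f v = i} = {v \<in> V. f v = i}" by blast
  ultimately show "finite (V \<inter> {v \<in> V. f v = i}) \<and> card (V \<inter> {v \<in> V. f v = i}) \<le> a"
    by (simp add: ecard_def split: if_splits)
qed

lemma kd_clique_Int_kd_independent:
  assumes "kd_clique k d V E S" "kd_independent k d V E I"
  shows "finite (S \<inter> I) \<and> card (S \<inter> I) < k"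
proof (rule ccontr)
  assume "\<not> ?thesis"
  \<comment> \<open>An infinite intersection also has a \<open>k\<close>-element subset, so one
    choice of \<open>T\<close> handles both ways of failing.\<close>
  then obtain T where T: "T \<subseteq> S \<inter> I" "finite T" "card T = k"
    by (metis infinite_arbitrarily_large not_less obtain_subset_with_card_n)
  then obtain p where p: "shortest_path V E p" "path_length p \<le> d" "T \<subseteq> set p"
    using assms(1) unfolding kd_clique_def by blast
  have "k \<le> card (set p \<inter> I)" using T p(3) using card_mono[of "set p \<inter> I" T] by auto
  then show False using assms(2) p by (auto simp: kd_independent_def)
qed

text \<open>The bound is uniform over all cliques, so it passes to the supremum without a largest
  clique being needed.\<close>

lemma kd_omega_le:
  assumes col: "kd_coloring k d V E c f" and "0 < k"
  shows "kd_omega k d V E \<le> enat (c * (k - 1))"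
  unfolding kd_omega_def
proof (rule Sup_least)
  fix x assume "x \<in> {ecard S | S. kd_clique k d V E S}"
  then obtain S where S: "kd_clique k d V E S" "x = ecard S" by blast
  then have "S \<subseteq> V" by (simp add: kd_clique_def)
  have "finite S \<and> card S \<le> c * (k - 1)"
  proof (rule card_le_if_coloring[OF col \<open>S \<subseteq> V\<close>])
    fix i assume "i \<in> {1..c}"
    then have "kd_independent k d V E {v \<in> V. f v = i}"
      using col by (simp add: kd_coloring_def)
    from kd_clique_Int_kd_independent[OF S(1) this] assms(2)
    show "finite (S \<inter> {v \<in> V. f v = i}) \<and> card (S \<inter> {v \<in> V. f v = i}) \<le> k - 1" by linarith
  qed
  then show "x \<le> enat (c * (k - 1))" by (simp add: S ecard_def)
qed

lemma kd_chi_le: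
  assumes "finite V" and S: "kd_independent k d V E S" and "2 \<le> k"
    and q: "card (V - S) \<le> q * (k - 1)"
  shows "kd_chi k d V E \<le> enat (q + 1)"
proof -
  obtain g where g: "bij_betw g (V - S) {0..<card (V - S)}"
    using ex_bij_betw_finite_nat[of "V - S"] assms(1) by auto
  \<comment> \<open>The enumeration \<open>g\<close> cuts \<open>V - S\<close> into consecutive
    blocks of length \<open>k - 1\<close>. Blocks are counted from 0 and color 1 is taken by
    \<open>S\<close>, hence the shift by 2.\<close>
  define f where "f v = (if v \<in> S then 1 else g v div (k - 1) + 2)" for v
  have "f v \<in> {1..q + 1}" if "v \<in> V" for v
  proof (cases "v \<in> S")
    case False
    then have "g v < card (V - S)" using bij_betwE[OF g] that by simp
    then have "g v < q * (k - 1)" using q by linarith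
    then have "g v div (k - 1) < q" using assms(3) by (simp add: div_less_iff_less_mult)
    then show ?thesis by (simp add: f_def)
  qed (simp add: f_def)
  moreover have "kd_independent k d V E {v \<in> V. f v = i}" for i
  proof (cases "i = 1")
    case True
    then have "{v \<in> V. f v = i} = S" using S by (auto simp: f_def kd_independent_def)
    then show ?thesis using S by simp
  next
    case False
    \<comment> \<open>Color \<open>i\<close> belongs to block \<open>i - 2\<close>, whose first
      index is \<open>?r\<close>. For \<open>i = 0\<close> the class is empty, so the truncated
      subtraction does no harm.\<close>
    let ?C = "{v \<in> V. f v = i}" and ?r = "(i - 2) * (k - 1)"
    have sub: "?C \<subseteq> V - S" using False by (auto simp: f_def)
    have "g ` ?C \<subseteq> {?r..<?r + (k - 1)}"
    proof clarsimp
      fix v assume v: "v \<in> V" "i = f v"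
      then have "g v div (k - 1) = i - 2" using False by (simp add: f_def split: if_splits)
      then have "?r + g v mod (k - 1) = g v" by (metis div_mult_mod_eq)
      moreover have "g v mod (k - 1) < k - 1" using assms(3) by simp
      ultimately show "(f v - 2) * (k - Suc 0) \<le> g v \<and> g v < (f v - 2) * (k - Suc 0) + (k - Suc 0)"
        using v by simp
    qed
    from card_mono[OF _ this] have "card (g ` ?C) \<le> k - 1" by simp
    moreover have "inj_on g ?C" using g sub by (meson bij_betw_def inj_on_subset)
    ultimately have "card ?C < k" using assms(3) by (simp add: card_image)
    then show ?thesis using assms(1) by (intro kd_independent_small) auto
  qed
  ultimately have "kd_coloring k d V E (q + 1) f" by (auto simp: kd_coloring_def)
  then show ?thesis unfolding kd_chi_def by (intro Inf_lower) auto
qed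

lemma eceiling_quotient_alpha_le_kd_chi:
  assumes "V \<noteq> {}" "2 \<le> k"
  shows "eceiling (ereal_of_enat (ecard V) / ereal_of_enat (kd_alpha k d V E))
           \<le> ereal_of_enat (kd_chi k d V E)"
proof (cases "kd_chi k d V E")
  case (enat c)
  then obtain f where f: "kd_coloring k d V E c f" by (rule kd_chi_attained)
  have "ereal_of_enat (ecard V) / ereal_of_enat (kd_alpha k d V E) \<le> ereal (of_int (int c))"
  \<comment> \<open>If the independence number is infinite, the quotient is 0 by convention, even
    for infinite \<open>V\<close>.\<close>
  proof (cases "kd_alpha k d V E")
    case (enat a)
    then have "0 < a" using kd_alpha_positive[OF assms, of d E] by (simp add: zero_enat_def)
    from card_le_colors_times_alpha[OF f enat] have "finite V" "real (card V) \<le> real c * real a"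
      by (simp_all flip: of_nat_mult)
    with \<open>0 < a\<close> show ?thesis by (simp add: enat ecard_def divide_le_eq)
  qed simp
  from eceiling_le[OF this] enat show ?thesis by simp
qed simp

lemma kd_chi_le_eceiling:
  assumes "2 \<le> k"
  shows "ereal_of_enat (kd_chi k d V E)
           \<le> eceiling ((ereal_of_enat (ecard V) - ereal_of_enat (kd_alpha k d V E))
                / ereal (real k - 1)) + 1"
proof (cases "finite V")
  case True
  have "kd_alpha k d V E \<le> enat (card V)"
    unfolding kd_alpha_def
    using True by (intro Sup_least) (auto simp: kd_independent_def ecard_def card_mono dest: finite_subset)
  then obtain a where a: "kd_alpha k d V E = enat a" by (cases "kd_alpha k d V E") auto
  obtain S where S: "kd_independent k d V E S" "ecard S = enat a"
    using kd_alpha_attained[OF a] assms by force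
  then have "S \<subseteq> V" by (simp add: kd_independent_def)
  then have card: "finite S" "card S = a" "a \<le> card V"
    using True S(2) by (auto simp: ecard_def card_mono split: if_splits)
  let ?x = "(real (card V) - real a) / (real k - 1)"
  \<comment> \<open>Nonnegativity ensures that \<open>nat\<close> does not change the ceiling, which
    becomes the number of groups \<open>q\<close> in \<open>kd_chi_le\<close>.\<close>
  have "0 \<le> ?x" using assms card by simp
  then have q: "real (nat \<lceil>?x\<rceil>) = of_int \<lceil>?x\<rceil>" by simp
  have "real (card (V - S)) = real (card V) - real a"
    using card \<open>S \<subseteq> V\<close> by (simp add: card_Diff_subset of_nat_diff)
  also have "\<dots> = ?x * (real k - 1)" using assms by simp
  also have "\<dots> \<le> of_int \<lceil>?x\<rceil> * (real k - 1)"
    using assms by (intro mult_right_mono) auto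
  also have "\<dots> = real (nat \<lceil>?x\<rceil> * (k - 1))"
    using assms q by (simp add: of_nat_diff)
  finally have "card (V - S) \<le> nat \<lceil>?x\<rceil> * (k - 1)" by linarith
  from kd_chi_le[OF True S(1) assms this]
  have "ereal_of_enat (kd_chi k d V E) \<le> ereal_of_enat (enat (nat \<lceil>?x\<rceil> + 1))"
    by (simp only: ereal_of_enat_le_iff)
  also have "\<dots> = eceiling (ereal ?x) + 1"
    using q by (simp add: eceiling_def one_ereal_def)
  finally show ?thesis using True a assms by (simp add: ecard_def)
next
  case False
  \<comment> \<open>The numerator is \<infinity> whether or not the independence number is finite,
    since \<infinity> - \<infinity> = \<infinity> here; dividing by the positive
    \<open>k - 1\<close> keeps it infinite.\<close>
  then show ?thesis using assms by (cases "kd_alpha k d V E") (simp_all add: ecard_def eceiling_def)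
qed

lemma eceiling_quotient_omega_le_kd_chi:
  assumes "2 \<le> k"
  shows "eceiling (ereal_of_enat (kd_omega k d V E) / ereal (real k - 1))
           \<le> ereal_of_enat (kd_chi k d V E)"
proof (cases "kd_chi k d V E")
  case (enat c)
  then obtain f where f: "kd_coloring k d V E c f" by (rule kd_chi_attained)
  then have "kd_omega k d V E \<le> enat (c * (k - 1))" using assms by (intro kd_omega_le) auto
  \<comment> \<open>A finite number of colors forces the clique number to be finite, so the rest is
    real arithmetic.\<close>
  then obtain w where w: "kd_omega k d V E = enat w" "w \<le> c * (k - 1)"
    by (cases "kd_omega k d V E") auto
  then have "real w \<le> real (c * (k - 1))" by linarith
  also have "\<dots> = real c * (real k - 1)" using assms by (simp add: of_nat_diff)
  finally have "ereal_of_enat (kd_omega k d V E) / ereal (real k - 1) \<le> ereal (of_int (int c))"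
    using assms w(1) by (simp add: divide_le_eq)
  from eceiling_le[OF this] enat show ?thesis by simp
qed simp

theorem proposition2p3:
  fixes V :: "'a set" and E :: "'a set set" and k d :: nat
  assumes "simple_graph V E" and "k \<ge> 2" and "d \<ge> 1"
  shows "eceiling (ereal_of_enat (ecard V) / ereal_of_enat (kd_alpha k d V E))
           \<le> ereal_of_enat (kd_chi k d V E) \<and>
         ereal_of_enat (kd_chi k d V E)
           \<le> eceiling ((ereal_of_enat (ecard V) - ereal_of_enat (kd_alpha k d V E))
                / ereal (real k - 1)) + 1 \<and>
         eceiling (ereal_of_enat (kd_omega k d V E) / ereal (real k - 1))
           \<le> ereal_of_enat (kd_chi k d V E)"
  using assms
  by (intro conjI eceiling_quotient_alpha_le_kd_chi kd_chi_le_eceiling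
      eceiling_quotient_omega_le_kd_chi) (simp_all add: simple_graph_def)

end
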